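(* Let $k$ be an integer with $k \ge 2$, and let $G$ be a disconnected graph. Then $G$ is a cograph minimal $(k,\infty)$-polar obstruction if and only if $G$ is a cograph minimal polar obstruction (i.e., a cograph minimal $(\infty,\infty)$-polar obstruction). Equivalently, a graph $G$ is a connected cograph minimal $(\infty,k)$-polar obstruction if and only if $G$ is a connected cograph minimal polar obstruction.
   Context: All graphs are finite and simple. A cograph is a graph with no induced subgraph isomorphic to the path $P_4$. A cluster is a graph that is a disjoint union of complete graphs. For $s,k \in \mathbb{Z}_{\ge 0}\cup\{\infty\}$, an $(s,k)$-polar partition of a graph $G$ is a partition $(A,B)$ of $V(G)$ (parts may be empty) such that $G[A]$ is a complete multipartite graph with at most $s$ parts and $G[B]$ is a cluster with at most $k$ components; the value $\infty$ means the corresponding number is unbounded. $G$ is $(s,k)$-polar if it admits an $(s,k)$-polar partition, and polar if it is $(\infty,\infty)$-polar. A cograph minimal $(s,k)$-polar obstruction is a cograph that is not $(s,k)$-polar but all of whose proper induced subgraphs are $(s,k)$-polar; a cograph minimal polar obstruction is a cograph minimal $(\infty,\infty)$-polar obstruction. *)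

theory Defs
  imports
    "Graph_Theory.Digraph_Component"
    "Graph_Theory.Digraph_Isomorphism"
    "HOL-Library.Disjoint_Sets"
    "HOL-Library.Extended_Nat"
begin

text \<open>
  A finite simple graph is a digraph satisfying the locale predicate \<^const>\<open>graph\<close>: finite,
  loop-free, without parallel arcs, and symmetric (an edge is a pair of opposite arcs).
\<close>

definition path4 :: "(nat, nat \<times> nat) pre_digraph" where
  "path4 = with_proj \<lparr> pverts = {0, 1, 2, 3},
     parcs = {(0, 1), (1, 0), (1, 2), (2, 1), (2, 3), (3, 2)} \<rparr>"

definition cograph :: "('a, 'b) pre_digraph \<Rightarrow> bool" where
  "cograph G \<longleftrightarrow> graph G \<and> \<not> (\<exists>H. induced_subgraph H G \<and> digraph_iso H path4)"

definition complete_multipartite_on :: "('a, 'b) pre_digraph \<Rightarrow> 'a set set \<Rightarrow> bool" where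
  "complete_multipartite_on G P \<longleftrightarrow> partition_on (verts G) P \<and>
     (\<forall>u\<in>verts G. \<forall>v\<in>verts G. u \<rightarrow>\<^bsub>G\<^esub> v \<longleftrightarrow> \<not> (\<exists>X\<in>P. u \<in> X \<and> v \<in> X))"

definition cluster :: "('a, 'b) pre_digraph \<Rightarrow> bool" where
  "cluster G \<longleftrightarrow> (\<exists>Q. partition_on (verts G) Q \<and>
     (\<forall>u\<in>verts G. \<forall>v\<in>verts G. u \<rightarrow>\<^bsub>G\<^esub> v \<longleftrightarrow> u \<noteq> v \<and> (\<exists>X\<in>Q. u \<in> X \<and> v \<in> X)))"

text \<open>
  In a symmetric digraph the strongly connected components \<^const>\<open>pre_digraph.sccs\<close> are the
  connected components of the undirected graph.
\<close>

definition polar_partition ::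
  "enat \<Rightarrow> enat \<Rightarrow> ('a, 'b) pre_digraph \<Rightarrow> 'a set \<Rightarrow> 'a set \<Rightarrow> bool" where
  "polar_partition s k G A B \<longleftrightarrow>
     A \<union> B = verts G \<and> A \<inter> B = {} \<and>
     (\<exists>P. complete_multipartite_on (G \<restriction> A) P \<and> enat (card P) \<le> s) \<and>
     cluster (G \<restriction> B) \<and> enat (card (pre_digraph.sccs (G \<restriction> B))) \<le> k"

definition polar :: "enat \<Rightarrow> enat \<Rightarrow> ('a, 'b) pre_digraph \<Rightarrow> bool" where
  "polar s k G \<longleftrightarrow> (\<exists>A B. polar_partition s k G A B)"

definition cograph_min_polar_obstruction ::
  "enat \<Rightarrow> enat \<Rightarrow> ('a, 'b) pre_digraph \<Rightarrow> bool" where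
  "cograph_min_polar_obstruction s k G \<longleftrightarrow> cograph G \<and> \<not> polar s k G \<and>
     (\<forall>H. induced_subgraph H G \<and> verts H \<subset> verts G \<longrightarrow> polar s k H)"

end

theory Submission
  imports Defs
begin

text \<open>
  Let \<open>V = X + Y\<close> be a separation of a disconnected graph. The multipartite side \<open>A\<close> of a polar
  partition is either independent or contained in one of \<open>X\<close>, \<open>Y\<close>; in the latter case the other
  side is a cluster, which can be removed without affecting \<open>(k,\<infinity>)\<close>-polarity. So a disconnected
  minimal \<open>(k,\<infinity>)\<close>-polar obstruction is not polar. Conversely, a disconnected minimal polar
  obstruction is the sum of a minimal graph \<open>X\<close> that is not monopolar (independent set plus
  cluster) and a minimal graph \<open>Y\<close> that is not a cluster. By Seinsche's theorem \<open>X\<close> is a join of two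
  smaller graphs. If one of them is independent, or is a clique and hence contains a universal
  vertex, then \<open>X\<close> is \<open>(2,\<infinity>)\<close>-polar: delete the independent side, respectively the universal vertex,
  take a monopolar partition of the rest, and add what was deleted as a second part; otherwise minimality forces both to be split graphs, and again
  \<open>X\<close> is \<open>(2,\<infinity>)\<close>-polar. Hence all proper induced subgraphs of \<open>X + Y\<close> are \<open>(2,\<infinity>)\<close>-polar. The
  connected case follows by complementation, again using Seinsche's theorem.
\<close>

section \<open>Polarity of adjacency relations\<close>

definition complement :: "('a \<Rightarrow> 'a \<Rightarrow> bool) \<Rightarrow> 'a \<Rightarrow> 'a \<Rightarrow> bool" where
  "complement E u v \<longleftrightarrow> u \<noteq> v \<and> \<not> E u v"

definition multipartite_rel :: "enat \<Rightarrow> ('a \<Rightarrow> 'a \<Rightarrow> bool) \<Rightarrow> 'a set \<Rightarrow> bool" where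
  "multipartite_rel s E A \<longleftrightarrow> (\<exists>P. partition_on A P \<and>
     (\<forall>u\<in>A. \<forall>v\<in>A. E u v \<longleftrightarrow> \<not> (\<exists>X\<in>P. u \<in> X \<and> v \<in> X)) \<and> enat (card P) \<le> s)"

text \<open>The cluster side is phrased as a complete multipartite set of the complement, so that
  complementation simply exchanges \<open>s\<close> and \<open>k\<close>.\<close>

definition polar_rel :: "enat \<Rightarrow> enat \<Rightarrow> ('a \<Rightarrow> 'a \<Rightarrow> bool) \<Rightarrow> 'a set \<Rightarrow> bool" where
  "polar_rel s k E V \<longleftrightarrow> (\<exists>A B. A \<union> B = V \<and> A \<inter> B = {} \<and>
     multipartite_rel s E A \<and> multipartite_rel k (complement E) B)"

definition min_polar_obstruction_rel ::
  "enat \<Rightarrow> enat \<Rightarrow> ('a \<Rightarrow> 'a \<Rightarrow> bool) \<Rightarrow> 'a set \<Rightarrow> bool" where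
  "min_polar_obstruction_rel s k E V \<longleftrightarrow>
     \<not> polar_rel s k E V \<and> (\<forall>W. W \<subset> V \<longrightarrow> polar_rel s k E W)"

definition P4_free :: "('a \<Rightarrow> 'a \<Rightarrow> bool) \<Rightarrow> 'a set \<Rightarrow> bool" where
  "P4_free E V \<longleftrightarrow> \<not> (\<exists>a\<in>V. \<exists>b\<in>V. \<exists>c\<in>V. \<exists>d\<in>V. distinct [a, b, c, d] \<and>
     E a b \<and> E b c \<and> E c d \<and> \<not> E a c \<and> \<not> E a d \<and> \<not> E b d)"

text \<open>For symmetric \<open>E\<close> and nonempty \<open>V\<close> this is disconnectedness;
  the empty set is not separable.\<close>

definition separable :: "('a \<Rightarrow> 'a \<Rightarrow> bool) \<Rightarrow> 'a set \<Rightarrow> bool" where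
  "separable E V \<longleftrightarrow> (\<exists>X Y. X \<noteq> {} \<and> Y \<noteq> {} \<and> X \<union> Y = V \<and> X \<inter> Y = {} \<and>
     (\<forall>x\<in>X. \<forall>y\<in>Y. \<not> E x y))"

definition indep :: "('a \<Rightarrow> 'a \<Rightarrow> bool) \<Rightarrow> 'a set \<Rightarrow> bool" where
  "indep E A \<longleftrightarrow> (\<forall>a\<in>A. \<forall>b\<in>A. \<not> E a b)"

definition clique :: "('a \<Rightarrow> 'a \<Rightarrow> bool) \<Rightarrow> 'a set \<Rightarrow> bool" where
  "clique E A \<longleftrightarrow> (\<forall>a\<in>A. \<forall>b\<in>A. a \<noteq> b \<longrightarrow> E a b)"

text \<open>Having no induced path on three vertices characterizes clusters.\<close>

definition P3_free :: "('a \<Rightarrow> 'a \<Rightarrow> bool) \<Rightarrow> 'a set \<Rightarrow> bool" where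
  "P3_free E B \<longleftrightarrow> (\<forall>a\<in>B. \<forall>b\<in>B. \<forall>c\<in>B. E a b \<longrightarrow> E b c \<longrightarrow> a \<noteq> c \<longrightarrow> E a c)"

text \<open>For finite simple graphs this is \<open>(1,\<infinity>)\<close>-polarity, written
  without partitions.\<close>

definition monopolar :: "('a \<Rightarrow> 'a \<Rightarrow> bool) \<Rightarrow> 'a set \<Rightarrow> bool" where
  "monopolar E V \<longleftrightarrow> (\<exists>A B. A \<union> B = V \<and> A \<inter> B = {} \<and> indep E A \<and> P3_free E B)"

section \<open>Heredity, minimal subsets and monotonicity in the bounds\<close>

lemma separableI:
  assumes "X \<noteq> {}" "Y \<noteq> {}" "X \<union> Y = V" "X \<inter> Y = {}" "\<And>x y. x \<in> X \<Longrightarrow> y \<in> Y \<Longrightarrow> \<not> E x y"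
  shows "separable E V"
  unfolding separable_def by (rule exI[of _ X], rule exI[of _ Y]) (use assms in blast)

lemma separableE:
  assumes "separable E V"
  obtains X Y where "X \<noteq> {}" "Y \<noteq> {}" "X \<union> Y = V" "X \<inter> Y = {}"
    "\<And>x y. x \<in> X \<Longrightarrow> y \<in> Y \<Longrightarrow> \<not> E x y"
proof -
  from assms obtain X Y where XY: "X \<noteq> {}" "Y \<noteq> {}" "X \<union> Y = V" "X \<inter> Y = {}"
      "\<forall>x\<in>X. \<forall>y\<in>Y. \<not> E x y"
    unfolding separable_def by (elim exE conjE) (rule that)
  show thesis by (rule that[OF XY(1-4)]) (use XY(5) in blast)
qed

lemma monopolarI:
  assumes "A \<union> B = V" "A \<inter> B = {}" "indep E A" "P3_free E B"
  shows "monopolar E V"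
  unfolding monopolar_def by (rule exI[of _ A], rule exI[of _ B]) (use assms in blast)

lemma P4_freeD:
  assumes "P4_free E V" "a \<in> V" "b \<in> V" "c \<in> V" "d \<in> V" "distinct [a, b, c, d]"
    "E a b" "E b c" "E c d" "\<not> E a c" "\<not> E a d" "\<not> E b d"
  shows False
  using assms unfolding P4_free_def by blast

lemma P4_free_subset: "P4_free E V \<Longrightarrow> W \<subseteq> V \<Longrightarrow> P4_free E W"
  unfolding P4_free_def by blast

lemma P3_free_subset: "P3_free E V \<Longrightarrow> W \<subseteq> V \<Longrightarrow> P3_free E W"
  unfolding P3_free_def by blast

lemma indep_subset: "indep E V \<Longrightarrow> W \<subseteq> V \<Longrightarrow> indep E W"
  unfolding indep_def by blast

lemma clique_imp_P3_free: "clique E V \<Longrightarrow> P3_free E V"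
  unfolding clique_def P3_free_def by blast

text \<open>Supplies the minimal non-monopolar, non-cluster and mixed vertex sets from which
  obstructions are assembled.\<close>

lemma finite_minimal_subset:
  assumes "finite V" "Q V"
  obtains W where "W \<subseteq> V" "Q W" "\<And>U. U \<subset> W \<Longrightarrow> \<not> Q U"
proof -
  have "\<exists>W\<subseteq>V. Q W \<and> (\<forall>U. U \<subset> W \<longrightarrow> \<not> Q U)"
    using assms
  proof (induction V rule: finite_psubset_induct)
    case (psubset V)
    show ?case
    proof (cases "\<exists>U. U \<subset> V \<and> Q U")
      case True
      then obtain U where "U \<subset> V" "Q U" by blast
      then show ?thesis using psubset.IH[of U] by (meson order.trans psubset_imp_subset)
    next
      case False
      then show ?thesis using psubset.prems by blast
    qed
  qed
  then show thesis using that by blast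
qed

lemma multipartite_rel_mono: "multipartite_rel s E A \<Longrightarrow> s \<le> t \<Longrightarrow> multipartite_rel t E A"
  unfolding multipartite_rel_def using order_trans[of _ s t] by blast

lemma polar_rel_mono:
  assumes "polar_rel s k E V" "s \<le> s'" "k \<le> k'"
  shows "polar_rel s' k' E V"
proof -
  obtain A B where "A \<union> B = V" "A \<inter> B = {}" "multipartite_rel s E A"
      "multipartite_rel k (complement E) B"
    using assms(1) unfolding polar_rel_def by blast
  with assms(2,3) show ?thesis
    unfolding polar_rel_def using multipartite_rel_mono[of s] multipartite_rel_mono[of k] by metis
qed

lemma separable_pair: "u \<noteq> v \<Longrightarrow> separable E {u, v} \<or> separable (complement E) {u, v}"
  by (cases "E u v") (auto simp: complement_def intro: separableI[of "{u}" "{v}"])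

section \<open>Complementation, and multipartite sets without partitions\<close>

locale simple_adjacency =
  fixes E :: "'a \<Rightarrow> 'a \<Rightarrow> bool"
  assumes adj_sym: "E u v \<Longrightarrow> E v u"
    and adj_irrefl: "\<not> E u u"
begin

lemma complement_simple: "simple_adjacency (complement E)"
  unfolding complement_def by unfold_locales (blast intro: adj_sym)+

lemma complement_complement: "complement (complement E) = E"
  by (auto simp: complement_def fun_eq_iff adj_irrefl)

lemma polar_rel_complement: "polar_rel s k (complement E) V \<longleftrightarrow> polar_rel k s E V"
  unfolding polar_rel_def complement_complement
  \<comment> \<open>\<open>ex_comm\<close> exchanges the two sides of the partition.\<close>
  by (subst ex_comm) (simp add: Un_commute Int_commute conj_commute)

lemma min_polar_obstruction_rel_complement:
  "min_polar_obstruction_rel s k (complement E) V \<longleftrightarrow> min_polar_obstruction_rel k s E V"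
  unfolding min_polar_obstruction_rel_def polar_rel_complement ..

text \<open>The path on four vertices is self-complementary: the complement of the path
  \<open>a b c d\<close> is the path \<open>b d a c\<close>.\<close>

lemma P4_free_complement:
  assumes "P4_free E V"
  shows "P4_free (complement E) V"
proof -
  have False if "a \<in> V" "b \<in> V" "c \<in> V" "d \<in> V" "distinct [a, b, c, d]"
    "\<not> E a b" "\<not> E b c" "\<not> E c d" "E a c" "E a d" "E b d" for a b c d
  proof -
    have "distinct [b, d, a, c]" "E b d" "E d a" "E a c" "\<not> E b a" "\<not> E b c" "\<not> E d c"
      using that adj_sym by auto
    with that assms show False unfolding P4_free_def by blast
  qed
  then show ?thesis unfolding P4_free_def complement_def by auto
qed

text \<open>The parts are the classes of non-adjacency, which is reflexive and symmetric, hence an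
  equivalence as soon as it is transitive.\<close>

lemma multipartite_rel_infinity:
  "multipartite_rel \<infinity> E A \<longleftrightarrow>
     (\<forall>a\<in>A. \<forall>b\<in>A. \<forall>c\<in>A. \<not> E a b \<longrightarrow> \<not> E b c \<longrightarrow> \<not> E a c)" (is "?L \<longleftrightarrow> ?R")
proof
  assume ?L
  then obtain P where P: "partition_on A P"
    "\<And>u v. u \<in> A \<Longrightarrow> v \<in> A \<Longrightarrow> E u v \<longleftrightarrow> \<not> (\<exists>X\<in>P. u \<in> X \<and> v \<in> X)"
    unfolding multipartite_rel_def by (elim exE conjE) (rule that, simp_all)
  show ?R
  proof (intro ballI impI)
    fix a b c assume abc: "a \<in> A" "b \<in> A" "c \<in> A" "\<not> E a b" "\<not> E b c"
    obtain X where X: "X \<in> P" "a \<in> X" "b \<in> X" using P(2)[of a b] abc by blast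
    obtain Y where Y: "Y \<in> P" "b \<in> Y" "c \<in> Y" using P(2)[of b c] abc by blast
    have "X = Y" using X Y partition_onD2[OF P(1)] unfolding disjoint_def by blast
    with X Y abc show "\<not> E a c" using P(2)[of a c] by blast
  qed
next
  assume R: ?R
  define r where "r = {(a, b). a \<in> A \<and> b \<in> A \<and> \<not> E a b}"
  have r: "equiv A r"
  proof (rule equivI)
    show "r \<subseteq> A \<times> A" by (auto simp: r_def)
    show "refl_on A r" by (auto simp: r_def refl_on_def adj_irrefl)
    show "sym r" unfolding r_def sym_def using adj_sym by blast
    show "trans r" unfolding r_def trans_def using R by blast
  qed
  have "E u v \<longleftrightarrow> \<not> (\<exists>X\<in>A // r. u \<in> X \<and> v \<in> X)" if "u \<in> A" "v \<in> A" for u v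
  proof
    assume "E u v"
    show "\<not> (\<exists>X\<in>A // r. u \<in> X \<and> v \<in> X)"
    proof
      assume "\<exists>X\<in>A // r. u \<in> X \<and> v \<in> X"
      then have "(u, v) \<in> r" using r by (meson quotient_eq_iff)
      with \<open>E u v\<close> show False by (simp add: r_def)
    qed
  next
    assume *: "\<not> (\<exists>X\<in>A // r. u \<in> X \<and> v \<in> X)"
    show "E u v"
    proof (rule ccontr)
      assume "\<not> E u v"
      then have "v \<in> r `` {u}" "u \<in> r `` {u}" using that adj_irrefl by (auto simp: r_def)
      moreover have "r `` {u} \<in> A // r" using that(1) by (rule quotientI)
      ultimately show False using * by blast
    qed
  qed
  then show ?L
    unfolding multipartite_rel_def using partition_on_quotient[OF r] by auto
qed

text \<open>Non-adjacency in the complement means equality or adjacency in \<open>E\<close>; its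
  transitivity is the absence of an induced three-vertex path.\<close>

lemma multipartite_rel_complement_infinity:
  "multipartite_rel \<infinity> (complement E) B \<longleftrightarrow> P3_free E B"
  unfolding simple_adjacency.multipartite_rel_infinity[OF complement_simple]
  unfolding P3_free_def complement_def using adj_irrefl by blast

lemma indep_imp_multipartite_rel: "indep E A \<Longrightarrow> multipartite_rel 1 E A"
  unfolding multipartite_rel_def
  \<comment> \<open>A partition has no empty block, so the block \<open>A\<close> is dropped when it
    is empty.\<close>
  by (rule exI[of _ "{A} - {{}}"], cases "A = {}";
      auto simp: indep_def partition_on_def disjoint_def one_enat_def)

lemma join_indep_multipartite_rel:
  assumes "indep E A1" "indep E A2" "\<And>x y. x \<in> A1 \<Longrightarrow> y \<in> A2 \<Longrightarrow> E x y"
  shows "multipartite_rel 2 E (A1 \<union> A2)"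
proof -
  let ?P = "{A1, A2} - {{}}"
  have disj: "A1 \<inter> A2 = {}" using assms(3) adj_irrefl by blast
  have "card ?P \<le> card {A1, A2}" by (rule card_mono) auto
  also have "\<dots> \<le> 2" by (simp add: card_insert_if)
  finally have "enat (card ?P) \<le> 2" by (simp add: numeral_eq_enat)
  moreover have "partition_on (A1 \<union> A2) ?P"
    using disj by (auto simp: partition_on_def disjoint_def)
  moreover have "E u v \<longleftrightarrow> \<not> (\<exists>X\<in>?P. u \<in> X \<and> v \<in> X)" if "u \<in> A1 \<union> A2" "v \<in> A1 \<union> A2" for u v
  proof -
    have "(\<exists>X\<in>?P. u \<in> X \<and> v \<in> X) \<longleftrightarrow> u \<in> A1 \<and> v \<in> A1 \<or> u \<in> A2 \<and> v \<in> A2" by auto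
    moreover have "E u v" if "u \<in> A1 \<and> v \<in> A2 \<or> u \<in> A2 \<and> v \<in> A1"
      using that assms(3) adj_sym by blast
    ultimately show ?thesis using that assms(1,2) disj unfolding indep_def by blast
  qed
  ultimately show ?thesis unfolding multipartite_rel_def by (intro exI[of _ ?P] conjI) auto
qed

section \<open>Polar partitions and unions without crossing edges\<close>

lemma P3_free_Un:
  assumes "P3_free E B1" "P3_free E B2" "\<And>x y. x \<in> B1 \<Longrightarrow> y \<in> B2 \<Longrightarrow> \<not> E x y"
  shows "P3_free E (B1 \<union> B2)"
  unfolding P3_free_def
proof (intro ballI impI)
  fix a b c assume abc: "a \<in> B1 \<union> B2" "b \<in> B1 \<union> B2" "c \<in> B1 \<union> B2" "E a b" "E b c" "a \<noteq> c"
  have same: "x \<in> B1 \<longleftrightarrow> y \<in> B1" "x \<in> B2 \<longleftrightarrow> y \<in> B2"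
    if "E x y" "x \<in> B1 \<union> B2" "y \<in> B1 \<union> B2" for x y
    using that assms(3)[of x y] assms(3)[of y x] adj_sym[of x y] by blast+
  then have "a \<in> B1 \<and> b \<in> B1 \<and> c \<in> B1 \<or> a \<in> B2 \<and> b \<in> B2 \<and> c \<in> B2"
    using abc same[of a b] same[of b c] by blast
  with abc assms(1,2) show "E a c" unfolding P3_free_def by blast
qed

lemma polar_rel_infinityI:
  assumes "A \<union> B = V" "A \<inter> B = {}" "multipartite_rel s E A" "P3_free E B"
  shows "polar_rel s \<infinity> E V"
  unfolding polar_rel_def
  by (rule exI[of _ A], rule exI[of _ B]) (use assms multipartite_rel_complement_infinity in blast)

lemma polar_rel_infinityE:
  assumes "polar_rel s \<infinity> E V"
  obtains A B where "A \<union> B = V" "A \<inter> B = {}" "multipartite_rel s E A" "P3_free E B"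
  using assms multipartite_rel_complement_infinity unfolding polar_rel_def by blast

text \<open>Disposes of graphs with at most one vertex, which Seinsche's theorem does not
  cover.\<close>

lemma polar_rel_singleton:
  assumes "V \<subseteq> {v}" "1 \<le> s" "1 \<le> k"
  shows "polar_rel s k E V"
proof -
  have "indep E V" "indep (complement E) {}" using assms(1) adj_irrefl by (auto simp: indep_def)
  then have "multipartite_rel s E V" "multipartite_rel k (complement E) {}"
    using indep_imp_multipartite_rel multipartite_rel_mono assms(2,3)
      simple_adjacency.indep_imp_multipartite_rel[OF complement_simple] by blast+
  then show ?thesis unfolding polar_rel_def by (metis Int_empty_right Un_empty_right)
qed

lemma monopolar_imp_polar_rel: "monopolar E V \<Longrightarrow> polar_rel 1 \<infinity> E V"
  unfolding monopolar_def using polar_rel_infinityI indep_imp_multipartite_rel by metis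

lemma monopolar_Un:
  assumes "monopolar E X" "monopolar E Y" "X \<inter> Y = {}" "\<And>x y. x \<in> X \<Longrightarrow> y \<in> Y \<Longrightarrow> \<not> E x y"
  shows "monopolar E (X \<union> Y)"
proof -
  obtain A B A' B' where *: "A \<union> B = X" "A \<inter> B = {}" "indep E A" "P3_free E B"
    "A' \<union> B' = Y" "A' \<inter> B' = {}" "indep E A'" "P3_free E B'"
    using assms(1,2) unfolding monopolar_def by blast
  have "indep E (A \<union> A')" using * assms(4) adj_sym unfolding indep_def by blast
  moreover have "P3_free E (B \<union> B')" using * assms(4) by (intro P3_free_Un) auto
  ultimately show ?thesis
    using * assms(3,4) by (intro monopolarI[of "A \<union> A'" "B \<union> B'"]) blast+
qed

text \<open>Suppose \<open>A\<close> contains \<open>x\<close> in \<open>X\<close> and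
  \<open>y\<close> in \<open>Y\<close>. Every vertex of \<open>A\<close> is non-adjacent to
  \<open>x\<close> or to \<open>y\<close>, hence lies in their common part, so \<open>A\<close> is a
  single part.\<close>

lemma multipartite_rel_separated:
  assumes "multipartite_rel \<infinity> E A" "A \<subseteq> X \<union> Y" "\<And>x y. x \<in> X \<Longrightarrow> y \<in> Y \<Longrightarrow> \<not> E x y"
  shows "indep E A \<or> A \<inter> X = {} \<or> A \<inter> Y = {}"
proof (rule ccontr)
  assume "\<not> ?thesis"
  then obtain x y where xy: "x \<in> A" "x \<in> X" "y \<in> A" "y \<in> Y" and "\<not> indep E A" by blast
  have tr: "\<And>a b c. a \<in> A \<Longrightarrow> b \<in> A \<Longrightarrow> c \<in> A \<Longrightarrow> \<not> E a b \<Longrightarrow> \<not> E b c \<Longrightarrow> \<not> E a c"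
    using assms(1) unfolding multipartite_rel_infinity by blast
  have nx: "\<not> E x a" if "a \<in> A" for a
    using that xy assms(2,3) tr[of x y a] adj_sym by blast
  have "\<not> E a b" if "a \<in> A" "b \<in> A" for a b
    using that tr[of a x b] nx adj_sym xy by blast
  with \<open>\<not> indep E A\<close> show False unfolding indep_def by blast
qed

text \<open>All of \<open>Y\<close> goes to the cluster side, so the multipartite side and its bound
  stay the same.\<close>

lemma polar_rel_add_cluster:
  assumes "polar_rel s \<infinity> E X" "P3_free E Y" "X \<inter> Y = {}"
    "\<And>x y. x \<in> X \<Longrightarrow> y \<in> Y \<Longrightarrow> \<not> E x y"
  shows "polar_rel s \<infinity> E (X \<union> Y)"
proof -
  obtain A B where *: "A \<union> B = X" "A \<inter> B = {}" "multipartite_rel s E A" "P3_free E B"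
    using assms(1) by (rule polar_rel_infinityE)
  have "P3_free E (B \<union> Y)" using * assms by (intro P3_free_Un) auto
  then show ?thesis using * assms(3) by (intro polar_rel_infinityI[of A "B \<union> Y"]) auto
qed

section \<open>Seinsche's theorem\<close>

text \<open>If \<open>v\<close> has no neighbour in \<open>X\<close>, then \<open>X\<close> splits
  off. Otherwise the non-neighbours of \<open>v\<close> in \<open>Y\<close> split off: an edge from
  such a \<open>y\<close> to a neighbour \<open>x\<close> of \<open>v\<close> in \<open>Y\<close>
  would give the induced path \<open>y x v z\<close>, where \<open>z\<close> is a neighbour of
  \<open>v\<close> in \<open>X\<close>.\<close>

lemma separable_extend:
  assumes P4: "P4_free E (insert v (X \<union> Y))" and v: "v \<notin> X \<union> Y"
    and XY: "X \<noteq> {}" "Y \<noteq> {}" "X \<inter> Y = {}" "\<And>x y. x \<in> X \<Longrightarrow> y \<in> Y \<Longrightarrow> \<not> E x y"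
    and w: "w \<in> Y" "\<not> E v w"
  shows "separable E (insert v (X \<union> Y))"
proof (cases "\<exists>z\<in>X. E v z")
  case False
  then show ?thesis
    using XY v adj_sym by (intro separableI[of X "insert v Y"]) blast+
next
  case True
  then obtain z where z: "z \<in> X" "E v z" by blast
  define W where "W = {y \<in> Y. \<not> E v y}"
  have "\<not> E y x" if "y \<in> W" "x \<in> Y - W" for x y
  proof
    assume "E y x"
    have "y \<in> Y" "x \<in> Y" "E x v" "\<not> E y v" "x \<noteq> y"
      using that adj_sym unfolding W_def by blast+
    moreover from this have "\<not> E y z" "\<not> E x z" "y \<noteq> z" "x \<noteq> z"
      using XY(3,4) z adj_sym by blast+
    ultimately show False
      using \<open>E y x\<close> z v by (intro P4_freeD[OF P4, of y x v z]) auto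
  qed
  then have "\<forall>y\<in>W. \<forall>x\<in>insert v (X \<union> (Y - W)). \<not> E y x"
    using XY(4) adj_sym unfolding W_def by blast
  moreover have "w \<in> W" "W \<union> insert v (X \<union> (Y - W)) = insert v (X \<union> Y)"
    "W \<inter> insert v (X \<union> (Y - W)) = {}"
    using w v XY(3) unfolding W_def by blast+
  ultimately show ?thesis by (intro separableI[of W "insert v (X \<union> (Y - W))"]) auto
qed

text \<open>A vertex adjacent to all of \<open>U\<close> splits off in the complement. Otherwise it
  has a non-neighbour on one of the two sides, and \<open>separable_extend\<close> applies with that
  side as the second.\<close>

lemma separable_insert:
  assumes "P4_free E (insert v U)" "v \<notin> U" "separable E U"
  shows "separable E (insert v U) \<or> separable (complement E) (insert v U)"
proof -
  obtain X Y where XY: "X \<noteq> {}" "Y \<noteq> {}" "X \<union> Y = U" "X \<inter> Y = {}" "\<And>x y. x \<in> X \<Longrightarrow> y \<in> Y \<Longrightarrow> \<not> E x y"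
    using assms(3) by (rule separableE) (rule that)
  show ?thesis
  proof (cases "\<forall>w\<in>U. E v w")
    case True
    then have "separable (complement E) (insert v U)"
      using assms(2) XY by (intro separableI[of "{v}" U]) (auto simp: complement_def)
    then show ?thesis ..
  next
    case False
    then obtain w where "w \<in> U" "\<not> E v w" by blast
    then consider "w \<in> Y" | "w \<in> X" using XY by blast
    then have "separable E (insert v U)"
    proof cases
      case 1
      then show ?thesis
        using separable_extend[of v X Y w] assms XY \<open>\<not> E v w\<close> by auto
    next
      case 2
      then show ?thesis
        using separable_extend[of v Y X w] assms XY \<open>\<not> E v w\<close> adj_sym
        by (metis Int_commute Un_commute)
    qed
    then show ?thesis ..
  qed
qed

end

text \<open>Seinsche's theorem, obtained by adding one vertex at a time.\<close>

lemma P4_free_separable: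
  assumes "simple_adjacency E" "finite V" "card V \<ge> 2" "P4_free E V"
  shows "separable E V \<or> separable (complement E) V"
  using assms(2-)
proof (induction V rule: finite_induct)
  case empty
  then show ?case by simp
next
  case (insert v U)
  interpret simple_adjacency E by fact
  interpret co: simple_adjacency "complement E" by (rule complement_simple)
  show ?case
  proof (cases "card U \<ge> 2")
    case True
    then have "separable E U \<or> separable (complement E) U"
      using insert P4_free_subset by blast
    then show ?thesis
      \<comment> \<open>If it is the complement that separates \<open>U\<close>, the insertion lemma
        is applied to the complement, which is again \<open>P4_free\<close>.\<close>
      using separable_insert[of v U] co.separable_insert[of v U] insert.hyps insert.prems
        P4_free_complement complement_complement by auto
  next
    case False
    with insert have "card U = 1" by simp
    then obtain u where "U = {u}" by (auto simp: card_1_singleton_iff)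
    then show ?thesis
      using insert.hyps separable_pair[of v u] by (auto simp: insert_commute)
  qed
qed

section \<open>Minimal non-monopolar cographs\<close>

context simple_adjacency
begin

text \<open>The independent side \<open>A\<close> cannot meet both sides of a join, so one of them
  lies in \<open>B\<close>. Two non-adjacent vertices of that side and a vertex of the other side
  outside \<open>A\<close> form an induced three-vertex path in \<open>B\<close>.\<close>

lemma not_monopolar_join:
  assumes "\<not> indep E X" "\<not> clique E X" "\<not> indep E Y" "\<not> clique E Y"
    and join: "\<And>x y. x \<in> X \<Longrightarrow> y \<in> Y \<Longrightarrow> E x y"
  shows "\<not> monopolar E (X \<union> Y)"
proof
  assume "monopolar E (X \<union> Y)"
  then obtain A B where AB: "A \<union> B = X \<union> Y" "indep E A" "P3_free E B"
    unfolding monopolar_def by blast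
  have *: False if h: "\<not> clique E X'" "\<not> indep E Y'" "\<And>x y. x \<in> X' \<Longrightarrow> y \<in> Y' \<Longrightarrow> E x y"
    "X' \<subseteq> B" "Y' \<subseteq> A \<union> B" for X' Y'
  proof -
    obtain x x' where x: "x \<in> X'" "x' \<in> X'" "x \<noteq> x'" "\<not> E x x'"
      using h(1) unfolding clique_def by blast
    have "\<not> Y' \<subseteq> A" using h(2) AB(2) indep_subset by blast
    then obtain b where "b \<in> Y'" "b \<in> B" using h by blast
    then have "E x b" "E b x'" using h(3) x adj_sym by blast+
    with x \<open>b \<in> B\<close> h(4) AB(3) show False unfolding P3_free_def by blast
  qed
  have "A \<inter> X = {} \<or> A \<inter> Y = {}" using AB(2) join unfolding indep_def by blast
  then show False
  proof
    assume "A \<inter> X = {}"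
    with AB(1) have "X \<subseteq> B" by blast
    with *[of X Y] assms AB(1) show False by blast
  next
    assume "A \<inter> Y = {}"
    with AB(1) have "Y \<subseteq> B" by blast
    with *[of Y X] assms AB(1) adj_sym show False by blast
  qed
qed

text \<open>Deleting any vertex leaves an independent set or a clique, and the deleted vertex alone
  can serve as the opposite kind.\<close>

lemma minimal_mixed_split:
  assumes "\<not> indep E X" "\<And>U. U \<subset> X \<Longrightarrow> indep E U \<or> clique E U"
  obtains A B where "A \<union> B = X" "A \<inter> B = {}" "indep E A" "clique E B"
proof -
  obtain v where v: "v \<in> X" using assms(1) unfolding indep_def by blast
  have "indep E {v}" "clique E {v}" using adj_irrefl by (auto simp: indep_def clique_def)
  moreover have "indep E (X - {v}) \<or> clique E (X - {v})" using v by (intro assms(2)) blast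
  ultimately show thesis using v that[of "X - {v}" "{v}"] that[of "{v}" "X - {v}"] by blast
qed

text \<open>\<open>X\<close> becomes a second part beside the independent side of a monopolar
  partition of \<open>Y\<close>.\<close>

lemma join_indep_polar:
  assumes "indep E X" "monopolar E Y" "\<And>x y. x \<in> X \<Longrightarrow> y \<in> Y \<Longrightarrow> E x y"
  shows "polar_rel 2 \<infinity> E (X \<union> Y)"
proof -
  obtain A B where AB: "A \<union> B = Y" "A \<inter> B = {}" "indep E A" "P3_free E B"
    using assms(2) unfolding monopolar_def by blast
  have "X \<inter> Y = {}" using assms(3) adj_irrefl by blast
  moreover have "multipartite_rel 2 E (X \<union> A)"
    using assms AB by (intro join_indep_multipartite_rel) auto
  ultimately show ?thesis using AB by (intro polar_rel_infinityI[of "X \<union> A" B]) auto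
qed

lemma universal_vertex_polar:
  assumes "v \<in> V" "\<And>w. w \<in> V - {v} \<Longrightarrow> E v w" "monopolar E (V - {v})"
  shows "polar_rel 2 \<infinity> E V"
  using join_indep_polar[of "{v}" "V - {v}"] assms adj_irrefl
  by (auto simp: indep_def insert_absorb)

text \<open>The source of the bound two in the theorem: one part fails for \<open>X\<close>, but two
  parts always suffice.\<close>

lemma minimal_nonmonopolar_polar:
  assumes fin: "finite X" and P4: "P4_free E X" and nm: "\<not> monopolar E X"
    and min: "\<And>W. W \<subset> X \<Longrightarrow> monopolar E W"
  shows "polar_rel 2 \<infinity> E X"
proof -
  have "card X \<ge> 2"
  proof (rule ccontr)
    assume "\<not> card X \<ge> 2"
    then have "card X \<le> Suc 0" by simp
    then have "indep E X" using fin adj_irrefl unfolding indep_def by (metis card_le_Suc0_iff_eq)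
    then show False
      using nm unfolding monopolar_def P3_free_def by (metis Int_empty_right Un_empty_right empty_iff)
  qed
  moreover have "\<not> separable E X"
  proof
    assume "separable E X"
    then obtain Y Z where YZ: "Y \<noteq> {}" "Z \<noteq> {}" "Y \<union> Z = X" "Y \<inter> Z = {}"
        "\<And>y z. y \<in> Y \<Longrightarrow> z \<in> Z \<Longrightarrow> \<not> E y z"
      by (rule separableE) (rule that)
    then have "monopolar E Y" "monopolar E Z" by (auto intro!: min)
    then show False using monopolar_Un[of Y Z] nm YZ by auto
  qed
  \<comment> \<open>A separation of the complement exhibits \<open>X\<close> as a join.\<close>
  ultimately have "separable (complement E) X"
    using P4_free_separable[OF simple_adjacency_axioms fin _ P4] by blast
  then obtain Y Z where YZ: "Y \<noteq> {}" "Z \<noteq> {}" "Y \<union> Z = X" "Y \<inter> Z = {}"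
      "\<And>y z. y \<in> Y \<Longrightarrow> z \<in> Z \<Longrightarrow> \<not> complement E y z"
    by (rule separableE) (rule that)
  then have YZ5: "\<And>y z. y \<in> Y \<Longrightarrow> z \<in> Z \<Longrightarrow> E y z" unfolding complement_def by blast
  have YZ': "\<And>y z. z \<in> Z \<Longrightarrow> y \<in> Y \<Longrightarrow> E z y" using YZ5 adj_sym by blast
  have mono: "monopolar E Y" "monopolar E Z" using YZ min by blast+
  consider "indep E Y" | "indep E Z" | "clique E Y" | "clique E Z"
    | "\<not> indep E Y" "\<not> clique E Y" "\<not> indep E Z" "\<not> clique E Z" by blast
  then show ?thesis
  proof cases
    case 1
    then show ?thesis using join_indep_polar[of Y Z] mono YZ YZ5 by auto
  next
    case 2
    then show ?thesis using join_indep_polar[of Z Y] mono YZ YZ' by (auto simp: Un_commute)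
  next
    case 3
    \<comment> \<open>Every vertex of the clique \<open>Y\<close> is universal in \<open>X\<close>:
      it is adjacent to the rest of \<open>Y\<close> and, by the join, to all of
      \<open>Z\<close>.\<close>
    obtain v where "v \<in> Y" using YZ by blast
    show ?thesis
    proof (rule universal_vertex_polar[of v])
      show "v \<in> X" using \<open>v \<in> Y\<close> YZ(3) by blast
      then show "monopolar E (X - {v})" by (intro min) blast
      show "E v w" if "w \<in> X - {v}" for w
        using that 3 YZ5[of v w] \<open>v \<in> Y\<close> YZ(3) by (auto simp: clique_def)
    qed
  next
    case 4
    obtain v where "v \<in> Z" using YZ by blast
    show ?thesis
    proof (rule universal_vertex_polar[of v])
      show "v \<in> X" using \<open>v \<in> Z\<close> YZ(3) by blast
      then show "monopolar E (X - {v})" by (intro min) blast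
      show "E v w" if "w \<in> X - {v}" for w
        using that 4 YZ'[of v w] \<open>v \<in> Z\<close> YZ(3) by (auto simp: clique_def)
    qed
  next
    case 5
    \<comment> \<open>Minimal mixed subsets of the two sides already form a non-monopolar join, so
      minimality of \<open>X\<close> leaves no room for other vertices.\<close>
    let ?mixed = "\<lambda>U. \<not> indep E U \<and> \<not> clique E U"
    obtain Y' where Y': "Y' \<subseteq> Y" "?mixed Y'" "\<And>U. U \<subset> Y' \<Longrightarrow> \<not> ?mixed U"
      using finite_minimal_subset[of Y ?mixed] 5 YZ fin by (metis finite_Un)
    obtain Z' where Z': "Z' \<subseteq> Z" "?mixed Z'" "\<And>U. U \<subset> Z' \<Longrightarrow> \<not> ?mixed U"
      using finite_minimal_subset[of Z ?mixed] 5 YZ fin by (metis finite_Un)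
    have "\<not> monopolar E (Y' \<union> Z')" using Y' Z' YZ5 by (intro not_monopolar_join) blast+
    moreover have "Y' \<union> Z' \<subseteq> X" using Y'(1) Z'(1) YZ(3) by blast
    ultimately have X: "X = Y' \<union> Z'" using min[of "Y' \<union> Z'"] by blast
    obtain A B where AB: "A \<union> B = Y'" "A \<inter> B = {}" "indep E A" "clique E B"
    proof (rule minimal_mixed_split[of Y'])
      show "\<not> indep E Y'" using Y'(2) by blast
      show "indep E U \<or> clique E U" if "U \<subset> Y'" for U using Y'(3)[OF that] by blast
    qed
    obtain C D where CD: "C \<union> D = Z'" "C \<inter> D = {}" "indep E C" "clique E D"
    proof (rule minimal_mixed_split[of Z'])
      show "\<not> indep E Z'" using Z'(2) by blast
      show "indep E U \<or> clique E U" if "U \<subset> Z'" for U using Z'(3)[OF that] by blast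
    qed
    have sub: "A \<subseteq> Y" "B \<subseteq> Y" "C \<subseteq> Z" "D \<subseteq> Z" using AB(1) CD(1) Y'(1) Z'(1) by blast+
    \<comment> \<open>The two independent sets become the two parts, and the two cliques merge into
      one.\<close>
    have "multipartite_rel 2 E (A \<union> C)"
      using AB(3) CD(3) by (rule join_indep_multipartite_rel) (use sub YZ5 in blast)
    moreover have "clique E (B \<union> D)"
      using AB(4) CD(4) sub YZ5 YZ' unfolding clique_def by blast
    moreover have "(A \<union> C) \<inter> (B \<union> D) = {}" using AB(2) CD(2) sub YZ(4) by blast
    moreover have "(A \<union> C) \<union> (B \<union> D) = X" using AB CD X by blast
    ultimately show ?thesis by (intro polar_rel_infinityI clique_imp_P3_free)
  qed
qed

section \<open>Minimal obstructions, separable or not\<close>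

text \<open>If the multipartite side met \<open>Y\<close>, its trace on \<open>X\<close> would be
  independent and \<open>X\<close> monopolar. So it misses \<open>Y\<close>, which would then be a
  cluster.\<close>

lemma not_polar_rel_disjoint_union:
  assumes "\<not> monopolar E X" "\<not> P3_free E Y" "\<And>x y. x \<in> X \<Longrightarrow> y \<in> Y \<Longrightarrow> \<not> E x y"
  shows "\<not> polar_rel \<infinity> \<infinity> E (X \<union> Y)"
proof
  assume "polar_rel \<infinity> \<infinity> E (X \<union> Y)"
  then obtain A B where AB: "A \<union> B = X \<union> Y" "A \<inter> B = {}" "multipartite_rel \<infinity> E A" "P3_free E B"
    by (rule polar_rel_infinityE)
  have "indep E (A \<inter> X)"
    if "\<not> A \<inter> Y = {}"
    using multipartite_rel_separated[OF AB(3), of X Y] that AB(1) assms(3)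
    unfolding indep_def by blast
  moreover have "P3_free E (B \<inter> X)" using P3_free_subset[OF AB(4)] by blast
  moreover have "(A \<inter> X) \<union> (B \<inter> X) = X" "(A \<inter> X) \<inter> (B \<inter> X) = {}" using AB by blast+
  ultimately have "A \<inter> Y = {}" using assms(1) unfolding monopolar_def by metis
  then have "Y \<subseteq> B" using AB(1) by blast
  then show False using AB(4) P3_free_subset assms(2) by blast
qed

text \<open>Once \<open>V\<close> is the sum of a minimal non-monopolar \<open>X'\<close> and a
  minimal non-cluster \<open>Y'\<close>, a proper subset either contains \<open>X'\<close> and meets
  \<open>Y'\<close> in a cluster, or is a sum of two monopolar sets.\<close>

lemma separable_min_obstruction_imp_finite_parts:
  assumes fin: "finite V" and P4: "P4_free E V" and s: "2 \<le> s"
    and sep: "separable E V" and obs: "min_polar_obstruction_rel \<infinity> \<infinity> E V"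
  shows "min_polar_obstruction_rel s \<infinity> E V"
proof -
  have np: "\<not> polar_rel \<infinity> \<infinity> E V" and pr: "\<And>W. W \<subset> V \<Longrightarrow> polar_rel \<infinity> \<infinity> E W"
    using obs unfolding min_polar_obstruction_rel_def by blast+
  obtain X0 Y0 where XY0: "X0 \<noteq> {}" "Y0 \<noteq> {}" "X0 \<union> Y0 = V" "X0 \<inter> Y0 = {}"
      "\<And>x y. x \<in> X0 \<Longrightarrow> y \<in> Y0 \<Longrightarrow> \<not> E x y"
    using sep by (rule separableE) (rule that)
  have "\<not> monopolar E V"
    using np monopolar_imp_polar_rel polar_rel_mono by (metis enat_ord_code(3))
  then have "\<not> monopolar E X0 \<or> \<not> monopolar E Y0"
    using monopolar_Un XY0 by blast
  \<comment> \<open>The sides are renamed so that the non-monopolar one is \<open>X\<close>.\<close>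
  then obtain X Y where XY: "X \<noteq> {}" "Y \<noteq> {}" "X \<union> Y = V" "X \<inter> Y = {}"
      "\<And>x y. x \<in> X \<Longrightarrow> y \<in> Y \<Longrightarrow> \<not> E x y" and nmX: "\<not> monopolar E X"
    using XY0 adj_sym by (metis Int_commute Un_commute)
  have ncY: "\<not> P3_free E Y"
    \<comment> \<open>\<open>X\<close> is polar as a proper subset, so a cluster \<open>Y\<close>
      could be added to it, making \<open>V\<close> polar.\<close>
    using polar_rel_add_cluster[of \<infinity> X Y] pr[of X] np XY by blast
  obtain X' where X': "X' \<subseteq> X" "\<not> monopolar E X'" "\<And>U. U \<subset> X' \<Longrightarrow> monopolar E U"
    using finite_minimal_subset[of X "\<lambda>U. \<not> monopolar E U"] nmX XY fin by (metis finite_Un)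
  obtain Y' where Y': "Y' \<subseteq> Y" "\<not> P3_free E Y'" "\<And>U. U \<subset> Y' \<Longrightarrow> P3_free E U"
    using finite_minimal_subset[of Y "\<lambda>U. \<not> P3_free E U"] ncY XY fin by (metis finite_Un)
  have disj: "X' \<inter> Y' = {}" using X'(1) Y'(1) XY(4) by blast
  have cross: "\<not> E x y" if "x \<in> X'" "y \<in> Y'" for x y
    using that X'(1) Y'(1) XY(5)[of x y] by blast
  have "\<not> polar_rel \<infinity> \<infinity> E (X' \<union> Y')"
    by (rule not_polar_rel_disjoint_union[OF X'(2) Y'(2) cross])
  moreover have "X' \<union> Y' \<subseteq> V" using X'(1) Y'(1) XY(3) by blast
  ultimately have V: "V = X' \<union> Y'" using pr[of "X' \<union> Y'"] by blast
  have "finite X'" using V fin by simp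
  moreover have "P4_free E X'" using P4 by (rule P4_free_subset) (simp add: V)
  ultimately have pX: "polar_rel 2 \<infinity> E X'" using X'(2,3) by (rule minimal_nonmonopolar_polar)
  \<comment> \<open>One vertex of \<open>Y'\<close> forms the independent side; what remains is a
    proper subset of \<open>Y'\<close>, hence a cluster.\<close>
  have mY: "monopolar E U" if U: "U \<subseteq> Y'" for U
  proof -
    obtain v where v: "v \<in> Y'" using Y'(2) unfolding P3_free_def by blast
    have "indep E (U \<inter> {v})" using adj_irrefl by (auto simp: indep_def)
    moreover have "P3_free E (U - {v})" using U v by (intro Y'(3)) blast
    ultimately show ?thesis
      by (intro monopolarI[of "U \<inter> {v}" "U - {v}"]) blast+
  qed
  have "polar_rel 2 \<infinity> E W" if W: "W \<subset> V" for W
  proof (cases "X' \<subseteq> W")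
    case True
    then have "P3_free E (W \<inter> Y')" using W V by (intro Y'(3)) blast
    moreover have "W = X' \<union> (W \<inter> Y')" using True W V by blast
    ultimately show ?thesis
      using polar_rel_add_cluster[OF pX, of "W \<inter> Y'"] disj cross by auto
  next
    case False
    then have "monopolar E (W \<inter> X')" by (intro X'(3)) blast
    moreover have "monopolar E (W \<inter> Y')" by (rule mY) blast
    ultimately have "monopolar E (W \<inter> X' \<union> W \<inter> Y')"
      by (rule monopolar_Un) (use disj cross in auto)
    moreover have "W \<inter> X' \<union> W \<inter> Y' = W" using W V by blast
    ultimately have "polar_rel 1 \<infinity> E W" using monopolar_imp_polar_rel by metis
    then show ?thesis by (rule polar_rel_mono) auto
  qed
  then show ?thesis
    using np s polar_rel_mono unfolding min_polar_obstruction_rel_def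
    by (metis enat_ord_code(3) order_refl)
qed

text \<open>In a polar partition of \<open>V\<close> either the multipartite side is one part, or a
  whole side of the separation is a cluster. That cluster can be added to the other side, which is
  \<open>(s,\<infinity>)\<close>-polar by minimality.\<close>

lemma separable_min_obstruction_imp_infinity:
  assumes s: "1 \<le> s" and sep: "separable E V" and obs: "min_polar_obstruction_rel s \<infinity> E V"
  shows "min_polar_obstruction_rel \<infinity> \<infinity> E V"
proof -
  have np: "\<not> polar_rel s \<infinity> E V" and pr: "\<And>W. W \<subset> V \<Longrightarrow> polar_rel s \<infinity> E W"
    using obs unfolding min_polar_obstruction_rel_def by blast+
  obtain X Y where XY: "X \<noteq> {}" "Y \<noteq> {}" "X \<union> Y = V" "X \<inter> Y = {}"
      "\<And>x y. x \<in> X \<Longrightarrow> y \<in> Y \<Longrightarrow> \<not> E x y"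
    using sep by (rule separableE) (rule that)
  have "\<not> polar_rel \<infinity> \<infinity> E V"
  proof
    assume "polar_rel \<infinity> \<infinity> E V"
    then obtain A B where AB: "A \<union> B = V" "A \<inter> B = {}" "multipartite_rel \<infinity> E A" "P3_free E B"
      by (rule polar_rel_infinityE)
    consider "indep E A" | "X \<subseteq> B" | "Y \<subseteq> B"
      using multipartite_rel_separated[OF AB(3), of X Y] AB(1) XY(3,5) by blast
    then show False
    proof cases
      case 1
      then have "polar_rel 1 \<infinity> E V" using AB indep_imp_multipartite_rel polar_rel_infinityI by blast
      then show False using np s polar_rel_mono by (metis order_refl)
    next
      case 2
      then have "P3_free E X" using AB P3_free_subset by blast
      then have "polar_rel s \<infinity> E (Y \<union> X)"
        using XY adj_sym by (intro polar_rel_add_cluster pr) blast+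
      then show False using np XY by (simp add: Un_commute)
    next
      case 3
      then have "P3_free E Y" using AB P3_free_subset by blast
      then have "polar_rel s \<infinity> E (X \<union> Y)"
        using XY by (intro polar_rel_add_cluster pr) blast+
      then show False using np XY by simp
    qed
  qed
  then show ?thesis
    using pr polar_rel_mono unfolding min_polar_obstruction_rel_def by (metis enat_ord_code(3))
qed

lemma separable_min_obstruction_iff:
  assumes "finite V" "P4_free E V" "2 \<le> s" "separable E V"
  shows "min_polar_obstruction_rel s \<infinity> E V \<longleftrightarrow> min_polar_obstruction_rel \<infinity> \<infinity> E V"
proof -
  have "1 \<le> s" using assms(3) by (rule order_trans[rotated]) auto
  then show ?thesis
    using assms separable_min_obstruction_imp_finite_parts separable_min_obstruction_imp_infinity
    by blast
qed

text \<open>By Seinsche's theorem the complement is separable, so the separable case applies to it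
  with the two bounds exchanged.\<close>

lemma not_separable_min_obstruction_iff:
  assumes "finite V" "P4_free E V" "2 \<le> k" "\<not> separable E V"
  shows "min_polar_obstruction_rel \<infinity> k E V \<longleftrightarrow> min_polar_obstruction_rel \<infinity> \<infinity> E V"
proof (cases "card V \<ge> 2")
  case True
  then have "separable (complement E) V"
    using P4_free_separable[OF simple_adjacency_axioms] assms by blast
  then show ?thesis
    using simple_adjacency.separable_min_obstruction_iff[OF complement_simple, of V k] assms
      P4_free_complement min_polar_obstruction_rel_complement by blast
next
  \<comment> \<open>A graph with at most one vertex is polar for both pairs of bounds, so neither
    side of the equivalence holds.\<close>
  case False
  then have "card V \<le> Suc 0" by simp
  then obtain v where v: "V \<subseteq> {v}"
    using assms(1) by (metis card_le_Suc0_iff_eq insertI1 subsetI singletonI)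
  have "1 \<le> k" using assms(3) by (rule order_trans[rotated]) auto
  then show ?thesis
    using polar_rel_singleton[OF v] unfolding min_polar_obstruction_rel_def by auto
qed

end

section \<open>Transfer to digraphs\<close>

lemma multipartite_rel_cong:
  assumes "\<And>u v. u \<in> A \<Longrightarrow> v \<in> A \<Longrightarrow> E u v \<longleftrightarrow> E' u v"
  shows "multipartite_rel s E A \<longleftrightarrow> multipartite_rel s E' A"
  unfolding multipartite_rel_def using assms by (simp cong: ball_cong)

lemma polar_rel_cong:
  assumes "\<And>u v. u \<in> V \<Longrightarrow> v \<in> V \<Longrightarrow> E u v \<longleftrightarrow> E' u v"
  shows "polar_rel s k E V \<longleftrightarrow> polar_rel s k E' V"
proof -
  have "multipartite_rel s E A \<longleftrightarrow> multipartite_rel s E' A"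
    "multipartite_rel k (complement E) A \<longleftrightarrow> multipartite_rel k (complement E') A"
    if "A \<subseteq> V" for A
    using that assms by (intro multipartite_rel_cong; auto simp: complement_def subset_iff)+
  then show ?thesis unfolding polar_rel_def by (metis Un_upper1 Un_upper2)
qed

abbreviation adjacency :: "('a, 'b) pre_digraph \<Rightarrow> 'a \<Rightarrow> 'a \<Rightarrow> bool" where
  "adjacency G \<equiv> \<lambda>u v. u \<rightarrow>\<^bsub>G\<^esub> v"

lemma (in wf_digraph) adjacency_induce_subgraph:
  "u \<rightarrow>\<^bsub>G \<restriction> A\<^esub> v \<longleftrightarrow> u \<in> A \<and> v \<in> A \<and> u \<rightarrow> v"
  by (auto simp: arcs_ends_conv induce_subgraph_def)

context graph
begin

lemma graph_induce_subgraph: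
  assumes "A \<subseteq> verts G"
  shows "graph (G \<restriction> A)"
proof -
  have ind: "induced_subgraph (G \<restriction> A) G" using assms by (rule induced_induce)
  then interpret H: digraph "G \<restriction> A" by (intro digraph_subgraph induced_imp_subgraph)
  show ?thesis using induced_graph_imp_symmetric[OF sym_arcs ind] by (rule H.graphI)
qed

lemma simple_adjacency: "simple_adjacency (adjacency G)"
  by unfold_locales (blast intro: graph_symmetric dest: adj_not_same)+

section \<open>Polarity of digraphs in terms of adjacency\<close>

text \<open>Reachability never leaves a block, and distinct vertices of a block are adjacent, so the
  components are exactly the blocks. This turns the component bound of
  \<open>polar_partition\<close> into a bound on blocks.\<close>

lemma sccs_of_cluster:
  assumes Q: "partition_on (verts G) Q"
    and adj: "\<And>u v. u \<in> verts G \<Longrightarrow> v \<in> verts G \<Longrightarrow>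
      u \<rightarrow> v \<longleftrightarrow> u \<noteq> v \<and> (\<exists>X\<in>Q. u \<in> X \<and> v \<in> X)"
  shows "card sccs = card Q"
proof -
  have sub: "X \<subseteq> verts G" if "X \<in> Q" for X using that partition_onD1[OF Q] by blast
  have uniq: "X = Y" if "X \<in> Q" "Y \<in> Q" "u \<in> X" "u \<in> Y" for X Y u
    using that partition_onD2[OF Q] unfolding disjoint_def by blast
  have reach_in: "v \<in> X" if "u \<rightarrow>\<^sup>* v" "X \<in> Q" "u \<in> X" for u v X
    using that
  proof (induction rule: reachable_induct)
    case base
    then show ?case by simp
  next
    case (step v w)
    then have "v \<in> X" "v \<in> verts G" "w \<in> verts G" using adj_in_verts by auto
    then obtain Y where "Y \<in> Q" "v \<in> Y" "w \<in> Y" using adj[of v w] step by blast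
    then show ?case using uniq[of X Y v] \<open>v \<in> X\<close> step by blast
  qed
  have reach: "u \<rightarrow>\<^sup>* v" if "X \<in> Q" "u \<in> X" "v \<in> X" for u v X
  proof (cases "u = v")
    case True
    then show ?thesis using that sub by auto
  next
    case False
    then have "u \<rightarrow> v" using that sub adj[of u v] by blast
    then show ?thesis by auto
  qed
  have scc: "scc_of u = X" if "X \<in> Q" "u \<in> X" for u X
    unfolding scc_of_def using that reach_in reach by blast
  have "scc_of ` verts G = Q"
  proof
    show "scc_of ` verts G \<subseteq> Q" using scc partition_onD1[OF Q] by blast
    show "Q \<subseteq> scc_of ` verts G"
    proof
      fix X assume "X \<in> Q"
      then obtain u where "u \<in> X" using partition_onD3[OF Q] by (metis all_not_in_conv)
      then show "X \<in> scc_of ` verts G" using scc[OF \<open>X \<in> Q\<close>] sub[OF \<open>X \<in> Q\<close>] by blast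
    qed
  qed
  then show ?thesis using card_sccs_verts sccs_verts_conv_scc_of by simp
qed

lemma cluster_iff_multipartite_rel:
  "cluster G \<and> enat (card sccs) \<le> k \<longleftrightarrow>
     multipartite_rel k (complement (adjacency G)) (verts G)"
proof -
  \<comment> \<open>On the diagonal both conditions hold automatically: there are no loops, and
    every vertex lies in some block.\<close>
  have eq: "(\<forall>u\<in>verts G. \<forall>v\<in>verts G. u \<rightarrow> v \<longleftrightarrow> u \<noteq> v \<and> (\<exists>X\<in>Q. u \<in> X \<and> v \<in> X)) \<longleftrightarrow>
      (\<forall>u\<in>verts G. \<forall>v\<in>verts G. complement (adjacency G) u v \<longleftrightarrow>
         \<not> (\<exists>X\<in>Q. u \<in> X \<and> v \<in> X))" (is "?L Q \<longleftrightarrow> ?R Q")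
    if Q: "partition_on (verts G) Q" for Q
  proof -
    have "\<not> u \<rightarrow> u" for u using simple_adjacency simple_adjacency.adj_irrefl by metis
    moreover have "\<exists>X\<in>Q. u \<in> X" if "u \<in> verts G" for u using that partition_onD1[OF Q] by blast
    ultimately show ?thesis unfolding complement_def by (intro ball_cong refl) metis
  qed
  have "card sccs = card Q" if "partition_on (verts G) Q" "?L Q" for Q
    using that(1) by (rule sccs_of_cluster) (use that(2) in blast)
  then have "cluster G \<and> enat (card sccs) \<le> k \<longleftrightarrow>
      (\<exists>Q. partition_on (verts G) Q \<and> ?L Q \<and> enat (card Q) \<le> k)"
    \<comment> \<open>The component bound is moved under the quantifier over \<open>Q\<close>, where
      it can be compared with \<open>card Q\<close>.\<close>
    unfolding cluster_def ex_simps(1)[symmetric] by (intro ex_cong1) auto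
  also have "\<dots> \<longleftrightarrow> (\<exists>Q. partition_on (verts G) Q \<and> ?R Q \<and> enat (card Q) \<le> k)"
    by (intro ex_cong1 conj_cong refl eq)
  finally show ?thesis unfolding multipartite_rel_def .
qed

lemma polar_iff_polar_rel: "polar s k G \<longleftrightarrow> polar_rel s k (adjacency G) (verts G)"
proof -
  have part: "polar_partition s k G A B \<longleftrightarrow> A \<union> B = verts G \<and> A \<inter> B = {} \<and>
      multipartite_rel s (adjacency G) A \<and> multipartite_rel k (complement (adjacency G)) B" for A B
  proof (cases "A \<union> B = verts G")
    case True
    \<comment> \<open>The covering condition places \<open>B\<close> inside the vertex set, so the
      restriction is again a graph and its components can be counted.\<close>
    then interpret B: graph "G \<restriction> B" by (intro graph_induce_subgraph) blast
    have "multipartite_rel k (complement (adjacency (G \<restriction> B))) B \<longleftrightarrow>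
        multipartite_rel k (complement (adjacency G)) B"
      by (rule multipartite_rel_cong) (simp add: complement_def adjacency_induce_subgraph)
    moreover have "multipartite_rel s (adjacency (G \<restriction> A)) A \<longleftrightarrow> multipartite_rel s (adjacency G) A"
      by (rule multipartite_rel_cong) (simp add: adjacency_induce_subgraph)
    ultimately show ?thesis
      using B.cluster_iff_multipartite_rel[of k]
      unfolding polar_partition_def complete_multipartite_on_def
        multipartite_rel_def[of s "adjacency (G \<restriction> A)"]
      by simp
  next
    case False
    then show ?thesis by (simp add: polar_partition_def)
  qed
  show ?thesis unfolding polar_def polar_rel_def by (rule ex_cong1, rule ex_cong1, rule part)
qed

text \<open>An induced subgraph is determined by its vertex set, so quantifying over proper induced
  subgraphs amounts to quantifying over proper vertex subsets.\<close>

lemma min_obstruction_iff_rel: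
  "cograph_min_polar_obstruction s k G \<longleftrightarrow>
     cograph G \<and> min_polar_obstruction_rel s k (adjacency G) (verts G)"
proof -
  have ind: "polar s k (G \<restriction> W) \<longleftrightarrow> polar_rel s k (adjacency G) W" if "W \<subseteq> verts G" for W
  proof -
    interpret W: graph "G \<restriction> W" using that by (rule graph_induce_subgraph)
    show ?thesis
      unfolding W.polar_iff_polar_rel induce_subgraph_verts
      by (rule polar_rel_cong) (simp add: adjacency_induce_subgraph)
  qed
  have "(\<forall>H. induced_subgraph H G \<and> verts H \<subset> verts G \<longrightarrow> polar s k H) \<longleftrightarrow>
      (\<forall>W. W \<subset> verts G \<longrightarrow> polar_rel s k (adjacency G) W)" (is "?L \<longleftrightarrow> ?R")
  proof
    assume L: ?L
    show ?R
    proof (intro allI impI)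
      fix W assume W: "W \<subset> verts G"
      then have "induced_subgraph (G \<restriction> W) G" by (intro induced_induce) blast
      then have "polar s k (G \<restriction> W)" using L W by simp
      then show "polar_rel s k (adjacency G) W" using ind W by blast
    qed
  next
    assume R: ?R
    show ?L
    proof (intro allI impI)
      fix H assume H: "induced_subgraph H G \<and> verts H \<subset> verts G"
      then have "polar s k (G \<restriction> verts H)" using R ind by blast
      moreover have "H = G \<restriction> verts H"
        using H by (intro induced_eq_verts_imp_eq[of H G]) auto
      ultimately show "polar s k H" by simp
    qed
  qed
  then show ?thesis
    unfolding cograph_min_polar_obstruction_def min_polar_obstruction_rel_def polar_iff_polar_rel
    by blast
qed

section \<open>Connectedness and induced paths in digraphs\<close>

text \<open>A walk cannot cross a separation; conversely, the set reachable from a vertex is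
  separated from its remainder. The library counts the empty graph as not connected.\<close>

lemma connected_iff_not_separable:
  "Digraph_Component.connected G \<longleftrightarrow> verts G \<noteq> {} \<and> \<not> separable (adjacency G) (verts G)"
proof -
  have con: "Digraph_Component.connected G \<longleftrightarrow>
      verts G \<noteq> {} \<and> (\<forall>u\<in>verts G. \<forall>v\<in>verts G. u \<rightarrow>\<^sup>* v)"
    unfolding connected_def strongly_connected_def using reachable_mk_symmetric_eq[OF sym_arcs] by simp
  have False if "separable (adjacency G) (verts G)" and r: "\<forall>u\<in>verts G. \<forall>v\<in>verts G. u \<rightarrow>\<^sup>* v"
  proof -
    obtain X Y where XY: "X \<noteq> {}" "Y \<noteq> {}" "X \<union> Y = verts G" "X \<inter> Y = {}"
        "\<And>x y. x \<in> X \<Longrightarrow> y \<in> Y \<Longrightarrow> \<not> x \<rightarrow> y"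
      using \<open>separable _ _\<close> by (rule separableE) (rule that)
    obtain x y where xy: "x \<in> X" "y \<in> Y" using XY by blast
    have "x \<rightarrow>\<^sup>* y" using r XY(3) xy by blast
    then have "y \<in> X" using xy(1)
    proof (induction rule: reachable_induct)
      case base
      then show ?case by simp
    next
      case (step v w)
      then show ?case using XY(3,5) adj_in_verts(2) by blast
    qed
    then show False using XY(4) xy by blast
  qed
  moreover have "separable (adjacency G) (verts G)"
    if uv: "u \<in> verts G" "v \<in> verts G" "\<not> u \<rightarrow>\<^sup>* v" for u v
  proof (rule separableI[of "{w. u \<rightarrow>\<^sup>* w}" "{w \<in> verts G. \<not> u \<rightarrow>\<^sup>* w}"])
    show "{w. u \<rightarrow>\<^sup>* w} \<noteq> {}" using uv(1) by auto
    show "{w. u \<rightarrow>\<^sup>* w} \<union> {w \<in> verts G. \<not> u \<rightarrow>\<^sup>* w} = verts G"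
      using reachable_in_verts by auto
    show "\<not> x \<rightarrow> y" if "x \<in> {w. u \<rightarrow>\<^sup>* w}" "y \<in> {w \<in> verts G. \<not> u \<rightarrow>\<^sup>* w}" for x y
      using that reachable_adj_trans by blast
  qed (use uv in auto)
  ultimately show ?thesis unfolding con by blast
qed

text \<open>An induced path given by adjacency is turned into an explicit isomorphism onto
  \<open>path4\<close>.\<close>

lemma cograph_imp_P4_free:
  assumes "cograph G"
  shows "P4_free (adjacency G) (verts G)"
  unfolding P4_free_def
proof (intro notI, elim bexE conjE)
  fix a b c d
  assume V: "a \<in> verts G" "b \<in> verts G" "c \<in> verts G" "d \<in> verts G" and dist: "distinct [a, b, c, d]"
    and e: "a \<rightarrow> b" "b \<rightarrow> c" "c \<rightarrow> d" and n: "\<not> a \<rightarrow> c" "\<not> a \<rightarrow> d" "\<not> b \<rightarrow> d"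
  interpret S: simple_adjacency "adjacency G" by (rule simple_adjacency)
  define H where "H = G \<restriction> {a, b, c, d}"
  have ind: "induced_subgraph H G" unfolding H_def using V by (intro induced_induce) blast
  interpret H: graph H unfolding H_def using V by (intro graph_induce_subgraph) blast
  have e': "b \<rightarrow> a" "c \<rightarrow> b" "d \<rightarrow> c" "\<not> c \<rightarrow> a" "\<not> d \<rightarrow> a" "\<not> d \<rightarrow> b"
    using e n S.adj_sym by blast+
  have ends: "arcs_ends H = {(a, b), (b, a), (b, c), (c, b), (c, d), (d, c)}"
    using e e' n S.adj_irrefl dist
    by (auto simp: H_def adjacency_induce_subgraph)
  \<comment> \<open>The last value also serves as default outside the path; only the four path
    vertices belong to \<open>H\<close>.\<close>
  define f :: "'a \<Rightarrow> nat" where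
    "f x = (if x = a then 0 else if x = b then 1 else if x = c then 2 else 3)" for x
  have f: "f a = 0" "f b = 1" "f c = 2" "f d = 3" using dist by (auto simp: f_def)
  \<comment> \<open>The arcs of \<open>path4\<close> are the pairs of their own ends, so each arc is
    sent to the images of its ends; \<open>H\<close> has no parallel arcs, which makes this
    injective.\<close>
  define h where "h = \<lparr>iso_verts = f, iso_arcs = (\<lambda>e. (f (tail H e), f (head H e))),
    iso_head = snd, iso_tail = fst\<rparr>"
  have injf: "inj_on f (verts H)" using f by (auto simp: H_def inj_on_def)
  have "inj_on (\<lambda>e. (f (tail H e), f (head H e))) (arcs H)"
  proof (rule inj_onI)
    fix x y assume xy: "x \<in> arcs H" "y \<in> arcs H"
      "(f (tail H x), f (head H x)) = (f (tail H y), f (head H y))"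
    then have "tail H x = tail H y" "head H x = head H y"
      using injf by (auto dest: inj_onD)
    with xy show "x = y" by (intro H.no_multi_arcs) (auto simp: arc_to_ends_def)
  qed
  then have "H.digraph_isomorphism h"
    using injf H.wf_digraph unfolding H.digraph_isomorphism_def h_def by simp
  moreover have "path4 = app_iso h H"
  proof -
    have "(\<lambda>e. (f (tail H e), f (head H e))) ` arcs H = map_prod f f ` arcs_ends H"
      by (auto simp: arcs_ends_conv image_image)
    also have "\<dots> = {(0, 1), (1, 0), (1, 2), (2, 1), (2, 3), (3, 2)}" by (simp add: ends f)
    finally show ?thesis
      unfolding path4_def app_iso_def h_def with_proj_def by (simp add: H_def f)
  qed
  ultimately have "digraph_iso H path4" unfolding digraph_iso_def by blast
  with assms ind show False unfolding cograph_def by blast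
qed

end

theorem theorem4:
  fixes k :: nat and G :: "('a, 'b) pre_digraph"
  assumes "k \<ge> 2" and "graph G"
  shows "(\<not> Digraph_Component.connected G \<longrightarrow>
            (cograph_min_polar_obstruction (enat k) \<infinity> G \<longleftrightarrow>
             cograph_min_polar_obstruction \<infinity> \<infinity> G))
       \<and> ((Digraph_Component.connected G \<and> cograph_min_polar_obstruction \<infinity> (enat k) G) \<longleftrightarrow>
          (Digraph_Component.connected G \<and> cograph_min_polar_obstruction \<infinity> \<infinity> G))"
proof -
  interpret graph G by fact
  interpret S: simple_adjacency "adjacency G" by (rule simple_adjacency)
  let ?E = "adjacency G" and ?V = "verts G"
  have k: "2 \<le> enat k" using assms(1) by (simp add: numeral_eq_enat)
  have k1: "1 \<le> enat k" using assms(1) by (simp add: one_enat_def)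
  have fin: "finite ?V" by simp
  show ?thesis
  proof (intro conjI impI)
    assume nc: "\<not> Digraph_Component.connected G"
    show "cograph_min_polar_obstruction (enat k) \<infinity> G \<longleftrightarrow> cograph_min_polar_obstruction \<infinity> \<infinity> G"
    proof (cases "?V = {}")
      \<comment> \<open>The empty graph is neither connected nor separable; it is polar, hence no
        obstruction.\<close>
      case True
      then have "polar_rel (enat k) \<infinity> ?E ?V" "polar_rel \<infinity> \<infinity> ?E ?V"
        using S.polar_rel_singleton k1 by auto
      then show ?thesis
        unfolding min_obstruction_iff_rel min_polar_obstruction_rel_def by blast
    next
      case False
      then have sep: "separable ?E ?V" using nc connected_iff_not_separable by blast
      show ?thesis
        unfolding min_obstruction_iff_rel
        using S.separable_min_obstruction_iff[OF fin cograph_imp_P4_free k sep] by blast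
    qed
  next
    show "(Digraph_Component.connected G \<and> cograph_min_polar_obstruction \<infinity> (enat k) G) \<longleftrightarrow>
        (Digraph_Component.connected G \<and> cograph_min_polar_obstruction \<infinity> \<infinity> G)"
      unfolding min_obstruction_iff_rel connected_iff_not_separable
      using S.not_separable_min_obstruction_iff[OF fin cograph_imp_P4_free k] by blast
  qed
qed

end
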